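(* Let $X\subset\mathbb{C}$ be a perfect, compact set. Let $\phi:X\to X$ be an analytic self-map of $X$ (that is, $\phi$ extends to an analytic function on a neighborhood of $X$). Let $(M_n)_{n\ge0}$ be a nonanalytic weight sequence. Set $K=\{z\in X:|\phi'(z)|\ge1\}$, and suppose that $\phi(K)\subset\operatorname{int}(X)$. Then $\phi$ induces an endomorphism of $D(X,M)$.
   Context: For a perfect compact set $X\subset\mathbb{C}$, a function $f:X\to\mathbb{C}$ is complex-differentiable at $a\in X$ if $f'(a)=\lim_{z\to a,\ z\in X}\frac{f(z)-f(a)}{z-a}$ exists; higher derivatives $f^{(n)}$ are defined by iteration, and $D^\infty(X)$ is the set of infinitely complex-differentiable functions on $X$. $\|\cdot\|_\infty$ is the sup norm over $X$. A weight sequence (algebra sequence) is a sequence $(M_n)_{n\ge0}$ of positive numbers with $M_0=1$ and $\binom{m+n}{n}\le\frac{M_{m+n}}{M_mM_n}$ for all $m,n\ge0$. It is nonanalytic if $\lim_{n\to\infty}(n!/M_n)^{1/n}=0$. Define $D(X,M)=\{f\in D^\infty(X):\|f\|_{D(X,M)}=\sum_{n=0}^\infty\frac{\|f^{(n)}\|_\infty}{M_n}<\infty\}$, a commutative normed algebra under pointwise operations (not necessarily complete). A map $\phi:X\to X$ induces an endomorphism of $D(X,M)$ if $f\circ\phi\in D(X,M)$ for all $f\in D(X,M)$. $\operatorname{int}(X)$ is the interior of $X$ in $\mathbb{C}$. *)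

theory Defs
  imports "HOL-Complex_Analysis.Complex_Analysis"
begin

(* Functions X -> C are total functions on complex of which only the values on X matter:
   all notions below depend on f only through its restriction to X, if every point of X
   is a limit point of X. *)

definition perfect :: "complex set \<Rightarrow> bool" where
  "perfect X \<longleftrightarrow> closed X \<and> (\<forall>x\<in>X. x islimpt X)"

(* The limit is taken inside X, so this is not deriv f a, which needs f near a in C. *)
definition deriv_in :: "complex set \<Rightarrow> (complex \<Rightarrow> complex) \<Rightarrow> complex \<Rightarrow> complex" where
  "deriv_in X f a = Lim (at a within X) (\<lambda>z. (f z - f a) / (z - a))"

abbreviation higher_deriv_in ::
    "complex set \<Rightarrow> nat \<Rightarrow> (complex \<Rightarrow> complex) \<Rightarrow> complex \<Rightarrow> complex" where
  "higher_deriv_in X n f \<equiv> (deriv_in X ^^ n) f"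

lemma deriv_in_eq:
  assumes "(f has_field_derivative D) (at a within X)" "a islimpt X"
  shows "deriv_in X f a = D"
  using assms unfolding deriv_in_def has_field_derivative_iff
  by (intro tendsto_Lim) (simp_all add: trivial_limit_within)

lemma deriv_in_cong:
  assumes "\<And>z. z \<in> X \<Longrightarrow> f z = g z" "a \<in> X"
  shows "deriv_in X f a = deriv_in X g a"
proof -
  have "((\<lambda>z. (f z - f a) / (z - a)) \<longlongrightarrow> L) (at a within X) \<longleftrightarrow>
        ((\<lambda>z. (g z - g a) / (z - a)) \<longlongrightarrow> L) (at a within X)" for L
    using assms by (intro filterlim_cong) (auto simp: eventually_at_filter)
  then show ?thesis
    by (simp add: deriv_in_def Topological_Spaces.Lim_def)
qed

(* holomorphic_on X, for X not necessarily open, says precisely that the function is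
   complex-differentiable within X at each point of X. *)
definition D_infty :: "complex set \<Rightarrow> (complex \<Rightarrow> complex) set" where
  "D_infty X = {f. \<forall>n. higher_deriv_in X n f holomorphic_on X}"

definition sup_norm :: "complex set \<Rightarrow> (complex \<Rightarrow> complex) \<Rightarrow> real" where
  "sup_norm X f = (SUP z\<in>X. norm (f z))"

definition weight_sequence :: "(nat \<Rightarrow> real) \<Rightarrow> bool" where
  "weight_sequence M \<longleftrightarrow> (\<forall>n. M n > 0) \<and> M 0 = 1 \<and>
     (\<forall>m n. real ((m + n) choose n) \<le> M (m + n) / (M m * M n))"

definition nonanalytic :: "(nat \<Rightarrow> real) \<Rightarrow> bool" where
  "nonanalytic M \<longleftrightarrow> (\<lambda>n. root n (fact n / M n)) \<longlonglongrightarrow> 0"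

(* The terms of the series are nonnegative, so summability is finiteness of its sum. Each
   sup norm is a genuine supremum: derivatives of f are continuous on the compact set X. *)
definition D_alg :: "complex set \<Rightarrow> (nat \<Rightarrow> real) \<Rightarrow> (complex \<Rightarrow> complex) set" where
  "D_alg X M = {f \<in> D_infty X. summable (\<lambda>n. sup_norm X (higher_deriv_in X n f) / M n)}"

definition extends_analytically :: "complex set \<Rightarrow> (complex \<Rightarrow> complex) \<Rightarrow> bool" where
  "extends_analytically X \<phi> \<longleftrightarrow>
     (\<exists>U g. open U \<and> X \<subseteq> U \<and> g holomorphic_on U \<and> (\<forall>z\<in>X. g z = \<phi> z))"

definition induces_endomorphism ::
    "complex set \<Rightarrow> (nat \<Rightarrow> real) \<Rightarrow> (complex \<Rightarrow> complex) \<Rightarrow> bool" where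
  "induces_endomorphism X M \<phi> \<longleftrightarrow> (\<forall>f \<in> D_alg X M. f \<circ> \<phi> \<in> D_alg X M)"

end

theory Submission
  imports Defs
begin

text \<open>
  Let \<open>g\<close> be holomorphic near \<open>X\<close> with \<open>g = \<phi>\<close> on \<open>X\<close>. Differentiating \<open>n\<close> times gives
  \<open>(f \<circ> \<phi>)\<^sup>(\<^sup>n\<^sup>) = \<Sum>k\<le>n. (f\<^sup>(\<^sup>k\<^sup>) \<circ> \<phi>) \<cdot> a\<^sub>n\<^sub>k\<close> on \<open>X\<close>, where the functions \<open>a\<^sub>n\<^sub>k\<close>, holomorphic near \<open>X\<close>,
  depend only on \<open>g\<close> (Faa di Bruno). No closed form of \<open>a\<^sub>n\<^sub>k\<close> is needed: the same formula for the
  polynomial \<open>w \<mapsto> (w - g z)\<^sup>k / k!\<close> in place of \<open>f\<close> shows that \<open>a\<^sub>n\<^sub>k z\<close> is the \<open>n\<close>-th derivative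
  of \<open>(g - g z)\<^sup>k / k!\<close> at \<open>z\<close>.

  The open sets \<open>{\<bar>g'\<bar> < 1}\<close> and \<open>g\<^sup>-\<^sup>1(int X)\<close> cover \<open>X\<close>, so by compactness there is one radius
  \<open>r > 0\<close> such that for every \<open>z \<in> X\<close> the closed disc of radius \<open>r\<close> about \<open>z\<close> lies in one of them.
  In the first case \<open>\<bar>g u - g z\<bar> \<le> \<bar>u - z\<bar>\<close> on the disc, and Cauchy's inequality yields
  \<open>\<bar>a\<^sub>n\<^sub>k z\<bar> \<le> (n!/k!) r\<^sup>k / r\<^sup>n\<close>. In the second case \<open>f \<circ> g\<close> is holomorphic on the disc and bounded by
  the supremum norm \<open>\<parallel>f\<parallel>\<close> over \<open>X\<close>, and Cauchy's inequality yields \<open>\<bar>(f \<circ> \<phi>)\<^sup>(\<^sup>n\<^sup>) z\<bar> \<le> n! \<parallel>f\<parallel> / r\<^sup>n\<close>. In both cases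
  \<open>\<bar>(f \<circ> \<phi>)\<^sup>(\<^sup>n\<^sup>) z\<bar> \<le> \<Sum>k\<le>n. \<parallel>f\<^sup>(\<^sup>k\<^sup>)\<parallel> (n!/k!) r\<^sup>k / r\<^sup>n\<close>.
  Since \<open>n!/M\<^sub>n \<le> (k!/M\<^sub>k) ((n-k)!/M\<^sub>n\<^sub>-\<^sub>k)\<close>, division by \<open>M\<^sub>n\<close> leaves at most the \<open>n\<close>-th term of the
  Cauchy product of the series \<open>\<Sum>k. \<parallel>f\<^sup>(\<^sup>k\<^sup>)\<parallel> / M\<^sub>k\<close> and \<open>\<Sum>j. j! / (M\<^sub>j r\<^sup>j)\<close>. The first converges because
  \<open>f\<close> is in the algebra, the second by the root test because \<open>M\<close> is nonanalytic.
\<close>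

section \<open>Higher derivatives of a composition\<close>

text \<open>The coefficient of the \<open>k\<close>-th derivative of the outer function in the \<open>n\<close>-th derivative of
  its composition with \<open>g\<close>, that is, the partial Bell polynomial \<open>B\<^sub>n\<^sub>k(g', g'', \<dots>)\<close>, given here by
  the recursion that the product rule produces.\<close>

fun comp_coeff :: "(complex \<Rightarrow> complex) \<Rightarrow> nat \<Rightarrow> nat \<Rightarrow> complex \<Rightarrow> complex" where
  "comp_coeff g 0 k = (\<lambda>z. if k = 0 then 1 else 0)"
| "comp_coeff g (Suc n) k =
     (\<lambda>z. deriv (comp_coeff g n k) z + (if k = 0 then 0 else deriv g z * comp_coeff g n (k - 1) z))"

lemma holomorphic_comp_coeff:
  assumes "g holomorphic_on U" "open U"
  shows "comp_coeff g n k holomorphic_on U"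
proof (induction n arbitrary: k)
  case 0
  show ?case by simp
next
  case (Suc n)
  have "comp_coeff g n k holomorphic_on U" "comp_coeff g n (k - 1) holomorphic_on U"
    by (rule Suc)+
  then show ?case
    using assms by (cases "k = 0") (auto intro!: holomorphic_intros)
qed

lemma comp_coeff_eq_0: "n < k \<Longrightarrow> comp_coeff g n k = (\<lambda>z. 0)"
proof (induction n arbitrary: k)
  case (Suc n)
  then have "comp_coeff g n k = (\<lambda>z. 0)" "comp_coeff g n (k - 1) = (\<lambda>z. 0)"
    by auto
  then show ?case
    using Suc.prems by (cases k) simp_all
qed simp

text \<open>The \<open>n\<close>-th derivative of \<open>F 0 \<circ> g\<close>, written out in terms of the sequence \<open>F\<close> of successive
  derivatives of \<open>F 0\<close>.\<close>

definition comp_deriv ::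
    "(nat \<Rightarrow> complex \<Rightarrow> complex) \<Rightarrow> (complex \<Rightarrow> complex) \<Rightarrow> nat \<Rightarrow> complex \<Rightarrow> complex" where
  "comp_deriv F g n z = (\<Sum>k\<le>n. F k (g z) * comp_coeff g n k z)"

lemma comp_deriv_0: "comp_deriv F g 0 z = F 0 (g z)"
  by (simp add: comp_deriv_def)

lemma comp_deriv_Suc:
  "comp_deriv F g (Suc n) z =
     (\<Sum>k\<le>n. F k (g z) * deriv (comp_coeff g n k) z
           + F (Suc k) (g z) * deriv g z * comp_coeff g n k z)"
proof -
  have "comp_deriv F g (Suc n) z =
      (\<Sum>k\<le>Suc n. F k (g z) * deriv (comp_coeff g n k) z)
    + (\<Sum>k\<le>Suc n. F k (g z) * (if k = 0 then 0 else deriv g z * comp_coeff g n (k - 1) z))"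
    unfolding comp_deriv_def sum.distrib [symmetric]
    by (intro sum.cong) (auto simp: algebra_simps)
  also have "(\<Sum>k\<le>Suc n. F k (g z) * deriv (comp_coeff g n k) z)
      = (\<Sum>k\<le>n. F k (g z) * deriv (comp_coeff g n k) z)"
    by (simp add: comp_coeff_eq_0)
  also have "(\<Sum>k\<le>Suc n. F k (g z) * (if k = 0 then 0 else deriv g z * comp_coeff g n (k - 1) z))
      = (\<Sum>k\<le>n. F (Suc k) (g z) * deriv g z * comp_coeff g n k z)"
    by (subst sum.atMost_Suc_shift) (simp add: mult.assoc)
  finally show ?thesis
    by (simp add: sum.distrib)
qed

text \<open>The domains \<open>S\<close> and \<open>Y\<close> need not be open; \<open>F k\<close> plays the role of the \<open>k\<close>-th derivative of
  \<open>F 0\<close> within \<open>Y\<close>.\<close>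

lemma has_field_derivative_comp_deriv:
  assumes F: "\<And>k w. w \<in> Y \<Longrightarrow> (F k has_field_derivative F (Suc k) w) (at w within Y)"
    and g: "g holomorphic_on U" "open U" and "S \<subseteq> U" "g ` S \<subseteq> Y" and z: "z \<in> S"
  shows "(comp_deriv F g n has_field_derivative comp_deriv F g (Suc n) z) (at z within S)"
proof -
  have "z \<in> U" using assms by auto
  have dg: "(g has_field_derivative deriv g z) (at z within S)"
    using holomorphic_derivI [OF g \<open>z \<in> U\<close>] by (rule has_field_derivative_at_within)
  have "((\<lambda>z. F k (g z) * comp_coeff g n k z) has_field_derivative
      (F k (g z) * deriv (comp_coeff g n k) z
           + F (Suc k) (g z) * deriv g z * comp_coeff g n k z)) (at z within S)" for k
  proof -
    have "(F k has_field_derivative F (Suc k) (g z)) (at (g z) within g ` S)"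
      using z assms(5) by (intro DERIV_subset [OF F assms(5)]) auto
    from DERIV_image_chain [OF this dg]
    have "((\<lambda>z. F k (g z)) has_field_derivative F (Suc k) (g z) * deriv g z) (at z within S)"
      by (simp add: o_def)
    moreover have "(comp_coeff g n k has_field_derivative deriv (comp_coeff g n k) z) (at z within S)"
      using holomorphic_derivI [OF holomorphic_comp_coeff [OF g] g(2) \<open>z \<in> U\<close>]
      by (rule has_field_derivative_at_within)
    ultimately show ?thesis
      by (auto intro!: derivative_eq_intros)
  qed
  then have "((\<lambda>z. \<Sum>k\<le>n. F k (g z) * comp_coeff g n k z) has_field_derivative
      comp_deriv F g (Suc n) z) (at z within S)"
    unfolding comp_deriv_Suc by (intro DERIV_sum)
  then show ?thesis
    by (simp add: comp_deriv_def [abs_def])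
qed

lemma higher_deriv_comp:
  assumes "\<And>k w. w \<in> Y \<Longrightarrow> (F k has_field_derivative F (Suc k) w) (at w within Y)"
    and "g holomorphic_on U" "open U" "S \<subseteq> U" "g ` S \<subseteq> Y" and "open S" and "z \<in> S"
  shows "(deriv ^^ n) (\<lambda>u. F 0 (g u)) z = comp_deriv F g n z"
  using \<open>z \<in> S\<close>
proof (induction n arbitrary: z)
  case 0
  show ?case by (simp add: comp_deriv_0)
next
  case (Suc n)
  have "\<forall>\<^sub>F u in nhds z. (deriv ^^ n) (\<lambda>u. F 0 (g u)) u = comp_deriv F g n u"
    using eventually_nhds_in_open [OF \<open>open S\<close> Suc.prems] by eventually_elim (rule Suc.IH)
  then have "(deriv ^^ Suc n) (\<lambda>u. F 0 (g u)) z = deriv (comp_deriv F g n) z"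
    by (simp add: deriv_cong_ev)
  also have "\<dots> = comp_deriv F g (Suc n) z"
    using has_field_derivative_comp_deriv [where F = F and Y = Y, OF assms(1-5) Suc.prems]
    by (intro DERIV_imp_deriv) (simp only: at_within_open [OF Suc.prems \<open>open S\<close>])
  finally show ?case .
qed

lemma higher_deriv_in_comp:
  assumes F: "\<And>k w. w \<in> Y \<Longrightarrow> (F k has_field_derivative F (Suc k) w) (at w within Y)"
    and g: "g holomorphic_on U" "open U" "X \<subseteq> U" "g ` X \<subseteq> Y"
    and h: "\<And>u. u \<in> X \<Longrightarrow> h u = F 0 (g u)"
    and "\<And>u. u \<in> X \<Longrightarrow> u islimpt X" and "z \<in> X"
  shows "higher_deriv_in X n h z = comp_deriv F g n z"
  using \<open>z \<in> X\<close>
proof (induction n arbitrary: z)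
  case 0
  then show ?case by (simp add: comp_deriv_0 h)
next
  case (Suc n)
  have "higher_deriv_in X (Suc n) h z = deriv_in X (comp_deriv F g n) z"
    using deriv_in_cong [of X "higher_deriv_in X n h", OF Suc.IH Suc.prems] by simp
  also have "\<dots> = comp_deriv F g (Suc n) z"
    using has_field_derivative_comp_deriv [where F = F and Y = Y, OF F g Suc.prems] assms(7) [OF Suc.prems]
    by (rule deriv_in_eq)
  finally show ?case .
qed

section \<open>Cauchy estimates\<close>

text \<open>The polynomial \<open>w \<mapsto> (w - g z)\<^sup>m / m!\<close> isolates the \<open>m\<close>-th coefficient, since its only
  nonzero derivative at \<open>g z\<close> is the \<open>m\<close>-th one, with value 1.\<close>

lemma comp_coeff_eq_higher_deriv:
  assumes "g holomorphic_on U" "open U" "z \<in> U" "m \<le> n"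
  shows "comp_coeff g n m z = (deriv ^^ n) (\<lambda>u. (g u - g z) ^ m / fact m) z"
proof -
  \<comment> \<open>\<open>F k\<close> is the \<open>k\<close>-th derivative of \<open>w \<mapsto> (w - g z)\<^sup>m / m!\<close>.\<close>
  define F where
    "F = (\<lambda>k w. if k \<le> m then (w - g z) ^ (m - k) / fact (m - k) else (0::complex))"
  have F: "(F k has_field_derivative F (Suc k) w) (at w within UNIV)" for k w
  proof (cases "k < m")
    case True
    then obtain j where j: "m = Suc (k + j)"
      using less_imp_Suc_add by blast
    have "F k = (\<lambda>w. (w - g z) ^ Suc j / fact (Suc j))" "F (Suc k) = (\<lambda>w. (w - g z) ^ j / fact j)"
      by (auto simp: F_def j Suc_diff_le)
    moreover have "((\<lambda>w. (w - g z) ^ Suc j / fact (Suc j)) has_field_derivative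
        (w - g z) ^ j / fact j) (at w)"
      by (rule derivative_eq_intros refl | simp del: of_nat_Suc add: fact_Suc)+
    ultimately show ?thesis by simp
  next
    case False
    then have "F k = (\<lambda>w. if k = m then 1 else 0)" "F (Suc k) = (\<lambda>w. 0)"
      by (auto simp: F_def fun_eq_iff)
    then show ?thesis by simp
  qed
  have "(deriv ^^ n) (\<lambda>u. F 0 (g u)) z = comp_deriv F g n z"
    using assms by (intro higher_deriv_comp [where F = F and Y = UNIV and U = U and S = U, OF F]) auto
  also have "\<dots> = (\<Sum>k\<le>n. if k = m then comp_coeff g n m z else 0)"
    unfolding comp_deriv_def by (intro sum.cong) (auto simp: F_def)
  also have "\<dots> = comp_coeff g n m z"
    using \<open>m \<le> n\<close> by simp
  finally show ?thesis
    by (simp add: F_def)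
qed

lemma norm_comp_coeff_le:
  assumes g: "g holomorphic_on U" "open U" and "cball z r \<subseteq> U" "0 < r" "k \<le> n"
    and le1: "\<And>u. u \<in> cball z r \<Longrightarrow> norm (deriv g u) \<le> 1"
  shows "norm (comp_coeff g n k z) \<le> fact n / fact k * r ^ k / r ^ n"
proof -
  \<comment> \<open>The mean value inequality on the convex disc.\<close>
  have lip: "norm (g u - g z) \<le> r" if "norm (z - u) = r" for u
  proof -
    have "norm (g u - g z) \<le> 1 * norm (u - z)"
    proof (rule field_differentiable_bound [of "cball z r" g "deriv g"])
      fix v assume "v \<in> cball z r"
      then show "(g has_field_derivative deriv g v) (at v within cball z r)"
        using g \<open>cball z r \<subseteq> U\<close> by (meson has_field_derivative_at_within holomorphic_derivI subsetD)
    qed (use le1 that \<open>0 < r\<close> in \<open>auto simp: dist_norm\<close>)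
    then show ?thesis
      using that by (simp add: norm_minus_commute)
  qed
  let ?h = "\<lambda>u. (g u - g z) ^ k / fact k"
  have hol: "?h holomorphic_on cball z r"
    using holomorphic_on_subset [OF g(1) \<open>cball z r \<subseteq> U\<close>] by (intro holomorphic_intros) auto
  have "norm ((deriv ^^ n) ?h z) \<le> fact n * (r ^ k / fact k) / r ^ n"
  proof (rule Cauchy_inequality)
    show "?h holomorphic_on ball z r"
      using hol by (rule holomorphic_on_subset) auto
    show "continuous_on (cball z r) ?h"
      using hol by (rule holomorphic_on_imp_continuous_on)
    fix u assume "norm (z - u) = r"
    then show "norm (?h u) \<le> r ^ k / fact k"
      using lip [of u] by (simp add: norm_divide norm_power divide_right_mono power_mono)
  qed fact
  moreover have "z \<in> U"
    using \<open>cball z r \<subseteq> U\<close> \<open>0 < r\<close> by auto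
  ultimately show ?thesis
    using comp_coeff_eq_higher_deriv [OF g _ \<open>k \<le> n\<close>, of z] by simp
qed

section \<open>The supremum norm and the algebra\<close>

lemma norm_le_sup_norm:
  assumes "compact X" "continuous_on X f" "z \<in> X"
  shows "norm (f z) \<le> sup_norm X f"
proof -
  have "bounded ((\<lambda>z. norm (f z)) ` X)"
    by (intro compact_imp_bounded compact_continuous_image continuous_intros assms)
  then have "bdd_above ((\<lambda>z. norm (f z)) ` X)"
    by (rule bounded_imp_bdd_above)
  then show ?thesis
    unfolding sup_norm_def using assms(3) by (rule cSUP_upper2) simp
qed

lemma sup_norm_nonneg:
  assumes "compact X" "continuous_on X f" "X \<noteq> {}"
  shows "0 \<le> sup_norm X f"
proof -
  obtain z where "z \<in> X"
    using assms(3) by blast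
  then have "norm (f z) \<le> sup_norm X f"
    by (rule norm_le_sup_norm [OF assms(1,2)])
  then show ?thesis
    by (rule order_trans [OF norm_ge_zero])
qed

lemma D_infty_has_field_derivative:
  assumes "perfect X" "f \<in> D_infty X" "w \<in> X"
  shows "(higher_deriv_in X n f has_field_derivative higher_deriv_in X (Suc n) f w) (at w within X)"
proof -
  have "higher_deriv_in X n f field_differentiable (at w within X)"
    using assms by (auto simp: D_infty_def holomorphic_on_def)
  then obtain D where D: "(higher_deriv_in X n f has_field_derivative D) (at w within X)"
    by (auto simp: field_differentiable_def)
  moreover have "deriv_in X (higher_deriv_in X n f) w = D"
    using assms D by (intro deriv_in_eq) (auto simp: perfect_def)
  ultimately show ?thesis by simp
qed

lemma D_infty_continuous_on:
  "f \<in> D_infty X \<Longrightarrow> continuous_on X (higher_deriv_in X n f)"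
  by (simp add: D_infty_def holomorphic_on_imp_continuous_on)

lemma nonanalytic_summable:
  assumes "weight_sequence M" "nonanalytic M" "0 < r"
  shows "summable (\<lambda>n. fact n / (M n * r ^ n))"
proof (rule root_test_convergence)
  have "(\<lambda>n. root n (fact n / M n) / r) \<longlonglongrightarrow> 0 / r"
    using assms by (intro tendsto_intros) (auto simp: nonanalytic_def)
  moreover have "\<forall>\<^sub>F n in sequentially.
      root n (fact n / M n) / r = root n (norm (fact n / (M n * r ^ n)))"
    using eventually_gt_at_top [of 0]
  proof eventually_elim
    case (elim n)
    have "M n > 0"
      using assms by (simp add: weight_sequence_def)
    then show ?case
      using elim \<open>0 < r\<close>
      by (simp add: abs_mult power_abs real_root_divide real_root_mult real_root_power_cancel)
  qed
  ultimately show "(\<lambda>n. root n (norm (fact n / (M n * r ^ n)))) \<longlonglongrightarrow> 0"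
    by (simp add: filterlim_cong)
qed simp

lemma weight_sequence_fact_le:
  assumes "weight_sequence M" "k \<le> n"
  shows "fact n / M n \<le> (fact k / M k) * (fact (n - k) / M (n - k))"
proof -
  have pos: "M k > 0" "M (n - k) > 0" "M n > 0"
    using assms by (auto simp: weight_sequence_def)
  have "real ((k + (n - k)) choose (n - k)) \<le> M (k + (n - k)) / (M k * M (n - k))"
    using assms unfolding weight_sequence_def by blast
  then have "real (n choose k) \<le> M n / (M k * M (n - k))"
    using assms(2) by (simp add: binomial_symmetric [symmetric])
  moreover have "real (n choose k) = fact n / (fact k * fact (n - k))"
    using assms(2) by (rule binomial_fact)
  ultimately show ?thesis
    using pos by (simp add: field_simps)
qed

section \<open>The uniform bound on the derivatives of the composition\<close>

text \<open>The radius comes from a Lebesgue number of the cover of \<open>X\<close> by \<open>{\<bar>g'\<bar> < 1}\<close> and the preimage of the interior.\<close>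

lemma uniform_radius:
  assumes g: "g holomorphic_on U" "open U" "X \<subseteq> U" and "compact X"
    and K: "\<And>z. z \<in> X \<Longrightarrow> norm (deriv g z) \<ge> 1 \<Longrightarrow> g z \<in> interior X"
  obtains r where "0 < r"
    "\<And>z. z \<in> X \<Longrightarrow> cball z r \<subseteq> U \<and>
       ((\<forall>u\<in>cball z r. norm (deriv g u) \<le> 1) \<or> g ` cball z r \<subseteq> interior X)"
proof -
  define V where "V = U \<inter> (\<lambda>u. norm (deriv g u)) -` {..<1}"
  define W where "W = U \<inter> g -` interior X"
  have "continuous_on U (\<lambda>u. norm (deriv g u))"
    using g by (intro continuous_intros holomorphic_on_imp_continuous_on holomorphic_deriv)
  then have "open V"
    unfolding V_def using g by (intro continuous_open_preimage) auto
  moreover have "open W"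
    unfolding W_def using g by (intro continuous_open_preimage holomorphic_on_imp_continuous_on) auto
  moreover have "X \<subseteq> \<Union>{V, W}"
    using g K by (auto simp: V_def W_def not_less)
  ultimately obtain e where "0 < e" and e: "\<And>z. z \<in> X \<Longrightarrow> \<exists>G\<in>{V, W}. ball z e \<subseteq> G"
    using Heine_Borel_lemma [OF \<open>compact X\<close>, of "{V, W}"] by blast
  show thesis
  proof (rule that [of "e / 2"])
    show "0 < e / 2" using \<open>0 < e\<close> by simp
    fix z assume "z \<in> X"
    moreover have "cball z (e / 2) \<subseteq> ball z e"
      using \<open>0 < e\<close> by auto
    ultimately have "cball z (e / 2) \<subseteq> V \<or> cball z (e / 2) \<subseteq> W"
      using e [of z] by blast
    moreover have "norm (deriv g u) \<le> 1" if "u \<in> V" for u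
      using that by (simp add: V_def)
    moreover have "V \<subseteq> U" "W \<subseteq> U" "g ` W \<subseteq> interior X"
      by (auto simp: V_def W_def)
    ultimately show "cball z (e / 2) \<subseteq> U \<and>
       ((\<forall>u\<in>cball z (e / 2). norm (deriv g u) \<le> 1) \<or> g ` cball z (e / 2) \<subseteq> interior X)"
      by blast
  qed
qed

text \<open>Where the disc maps into the interior of \<open>X\<close>, the coefficients \<open>comp_coeff g n k z\<close> may be large,
  but the sum is then a derivative of a holomorphic function on the disc. Its Cauchy bound is the
  summand \<open>k = 0\<close> on the right-hand side, so that the bound has the same form in both cases.\<close>

lemma norm_comp_deriv_le:
  assumes F: "\<And>k w. w \<in> X \<Longrightarrow> (F k has_field_derivative F (Suc k) w) (at w within X)"
    and B: "\<And>k w. w \<in> X \<Longrightarrow> norm (F k w) \<le> B k"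
    and g: "g holomorphic_on U" "open U" and z: "g z \<in> X" "cball z r \<subseteq> U" "0 < r"
    and cases: "(\<forall>u\<in>cball z r. norm (deriv g u) \<le> 1) \<or> g ` cball z r \<subseteq> interior X"
  shows "norm (comp_deriv F g n z) \<le> (\<Sum>k\<le>n. B k * (fact n / fact k * r ^ k / r ^ n))"
  using cases
proof
  assume "\<forall>u\<in>cball z r. norm (deriv g u) \<le> 1"
  then have "norm (comp_coeff g n k z) \<le> fact n / fact k * r ^ k / r ^ n" if "k \<le> n" for k
    using g z that by (intro norm_comp_coeff_le) auto
  moreover have "0 \<le> B k" for k
    using B [OF z(1), of k] norm_ge_zero order_trans by blast
  ultimately show ?thesis
    unfolding comp_deriv_def using B [OF z(1)]
    by (intro sum_norm_le) (simp only: norm_mult, intro mult_mono, auto)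
next
  assume *: "g ` cball z r \<subseteq> interior X"
  have F': "(F k has_field_derivative F (Suc k) w) (at w within interior X)"
    if "w \<in> interior X" for k w
  proof -
    have "w \<in> X"
      using that interior_subset by (rule subsetD [rotated])
    then show ?thesis
      by (rule DERIV_subset [OF F interior_subset])
  qed
  have B0: "0 \<le> B k" for k
    using B [OF z(1), of k] norm_ge_zero order_trans by blast
  have "comp_deriv F g n z = (deriv ^^ n) (\<lambda>u. F 0 (g u)) z"
    using * z g
    by (intro higher_deriv_comp [where F = F and Y = "interior X" and U = U and S = "ball z r", OF F', symmetric]) auto
  also have "norm \<dots> \<le> fact n * B 0 / r ^ n"
  proof (rule Cauchy_inequality)
    have "F 0 holomorphic_on interior X"
      using F' by (auto simp: holomorphic_on_def field_differentiable_def)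
    then have "F 0 \<circ> g holomorphic_on cball z r"
      using * g z by (intro holomorphic_on_compose_gen) (auto intro: holomorphic_on_subset)
    then have hol: "(\<lambda>u. F 0 (g u)) holomorphic_on cball z r"
      by (simp add: o_def)
    show "(\<lambda>u. F 0 (g u)) holomorphic_on ball z r"
      using hol by (rule holomorphic_on_subset) auto
    show "continuous_on (cball z r) (\<lambda>u. F 0 (g u))"
      using hol by (rule holomorphic_on_imp_continuous_on)
    fix u assume "norm (z - u) = r"
    then have "u \<in> cball z r"
      by (simp add: dist_norm)
    then have "g u \<in> interior X"
      using * by blast
    then show "norm (F 0 (g u)) \<le> B 0"
      by (intro B) (rule subsetD [OF interior_subset])
  qed (rule z)
  also have "\<dots> = (\<Sum>k\<in>{0}. B k * (fact n / fact k * r ^ k / r ^ n))"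
    by simp
  also have "\<dots> \<le> (\<Sum>k\<le>n. B k * (fact n / fact k * r ^ k / r ^ n))"
    using B0 \<open>0 < r\<close> by (intro sum_mono2) auto
  finally show ?thesis .
qed

section \<open>The endomorphism\<close>

lemma comp_mem_D_alg:
  assumes X: "perfect X" "compact X" "X \<noteq> {}" and \<phi>: "\<phi> \<in> X \<rightarrow> X"
    and g: "g holomorphic_on U" "open U" "X \<subseteq> U" "\<And>z. z \<in> X \<Longrightarrow> g z = \<phi> z"
    and M: "weight_sequence M" "nonanalytic M"
    and K: "\<And>z. z \<in> X \<Longrightarrow> norm (deriv g z) \<ge> 1 \<Longrightarrow> g z \<in> interior X"
    and f: "f \<in> D_alg X M"
  shows "f \<circ> \<phi> \<in> D_alg X M"
proof -
  define F where "F = (\<lambda>k. higher_deriv_in X k f)"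
  define B where "B = (\<lambda>k. sup_norm X (F k))"
  have fD: "f \<in> D_infty X" and sumB: "summable (\<lambda>k. B k / M k)"
    using f by (auto simp: D_alg_def B_def F_def)
  have Mpos: "M n > 0" for n
    using M by (simp add: weight_sequence_def)
  have F: "(F k has_field_derivative F (Suc k) w) (at w within X)" if "w \<in> X" for k w
    unfolding F_def by (rule D_infty_has_field_derivative [OF X(1) fD that])
  have B: "norm (F k w) \<le> B k" if "w \<in> X" for k w
    unfolding B_def F_def by (rule norm_le_sup_norm [OF X(2) D_infty_continuous_on [OF fD] that])
  have B0: "0 \<le> B k" for k
    unfolding B_def F_def by (rule sup_norm_nonneg [OF X(2) D_infty_continuous_on [OF fD] X(3)])
  have gX: "g ` X \<subseteq> X"
    using g \<phi> by auto
  have eq: "higher_deriv_in X n (f \<circ> \<phi>) z = comp_deriv F g n z" if "z \<in> X" for n z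
    using X(1) that
    by (intro higher_deriv_in_comp [where F = F and Y = X, OF F g(1-3) gX]) (auto simp: perfect_def F_def g)
  have D: "f \<circ> \<phi> \<in> D_infty X"
    unfolding D_infty_def
  proof (intro CollectI allI)
    fix n
    have "comp_deriv F g n holomorphic_on X"
      using has_field_derivative_comp_deriv [where F = F and Y = X, OF F g(1-3) gX]
      by (auto simp: holomorphic_on_def field_differentiable_def)
    then show "higher_deriv_in X n (f \<circ> \<phi>) holomorphic_on X"
      by (rule holomorphic_transform) (simp add: eq)
  qed
  obtain r where "0 < r" and r: "\<And>z. z \<in> X \<Longrightarrow> cball z r \<subseteq> U \<and>
       ((\<forall>u\<in>cball z r. norm (deriv g u) \<le> 1) \<or> g ` cball z r \<subseteq> interior X)"
    using uniform_radius [OF g(1-3) X(2) K] by metis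
  define c where "c = (\<lambda>n. fact n / (M n * r ^ n))"
  have c0: "0 \<le> c n" for n
    using Mpos [of n] \<open>0 < r\<close> by (simp add: c_def)
  have bound: "sup_norm X (higher_deriv_in X n (f \<circ> \<phi>)) / M n \<le> (\<Sum>k\<le>n. B k / M k * c (n - k))" for n
  proof -
    have "sup_norm X (higher_deriv_in X n (f \<circ> \<phi>)) \<le> (\<Sum>k\<le>n. B k * (fact n / fact k * r ^ k / r ^ n))"
      unfolding sup_norm_def
    proof (rule cSUP_least [OF X(3)])
      fix z assume "z \<in> X"
      then show "norm (higher_deriv_in X n (f \<circ> \<phi>) z) \<le> (\<Sum>k\<le>n. B k * (fact n / fact k * r ^ k / r ^ n))"
        unfolding eq [OF \<open>z \<in> X\<close>] using r \<open>0 < r\<close> gX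
        by (intro norm_comp_deriv_le [where F = F and X = X, OF F B g(1,2)]) auto
    qed
    then have "sup_norm X (higher_deriv_in X n (f \<circ> \<phi>)) / M n
        \<le> (\<Sum>k\<le>n. B k * (fact n / fact k * r ^ k / r ^ n)) / M n"
      using Mpos [of n] by (intro divide_right_mono) auto
    also have "\<dots> = (\<Sum>k\<le>n. B k * (r ^ k / r ^ n / fact k) * (fact n / M n))"
      unfolding sum_divide_distrib by (intro sum.cong) (simp_all add: mult_ac)
    also have "\<dots> \<le> (\<Sum>k\<le>n. B k / M k * c (n - k))"
    proof (rule sum_mono)
      fix k assume "k \<in> {..n}"
      then have "k \<le> n" by simp
      have pow: "r ^ k / r ^ n = 1 / r ^ (n - k)"
        using \<open>k \<le> n\<close> \<open>0 < r\<close> by (simp add: power_diff)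
      have "B k * (r ^ k / r ^ n / fact k) * (fact n / M n)
          \<le> B k * (r ^ k / r ^ n / fact k) * ((fact k / M k) * (fact (n - k) / M (n - k)))"
        using B0 \<open>0 < r\<close> weight_sequence_fact_le [OF M(1) \<open>k \<le> n\<close>] by (intro mult_left_mono) auto
      also have "\<dots> = B k / M k * c (n - k)"
        unfolding pow by (simp add: c_def)
      finally show "B k * (r ^ k / r ^ n / fact k) * (fact n / M n) \<le> B k / M k * c (n - k)" .
    qed
    finally show ?thesis .
  qed
  have summ: "summable (\<lambda>n. \<Sum>k\<le>n. B k / M k * c (n - k))"
  proof (rule summable_Cauchy_product)
    show "summable (\<lambda>k. norm (B k / M k))"
      using sumB B0 Mpos by (simp add: abs_of_pos)
    show "summable (\<lambda>k. norm (c k))"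
      unfolding real_norm_def abs_of_nonneg [OF c0]
      using nonanalytic_summable [OF M \<open>0 < r\<close>] by (simp add: c_def)
  qed
  have nonneg: "0 \<le> sup_norm X (higher_deriv_in X n (f \<circ> \<phi>)) / M n" for n
    using sup_norm_nonneg [OF X(2) D_infty_continuous_on [OF D] X(3)] Mpos [of n] by simp
  have "summable (\<lambda>n. sup_norm X (higher_deriv_in X n (f \<circ> \<phi>)) / M n)"
  proof (rule summable_comparison_test' [OF summ])
    show "norm (sup_norm X (higher_deriv_in X n (f \<circ> \<phi>)) / M n) \<le> (\<Sum>k\<le>n. B k / M k * c (n - k))"
      for n
      unfolding real_norm_def abs_of_nonneg [OF nonneg] by (rule bound)
  qed
  with D show ?thesis
    by (simp add: D_alg_def)
qed

theorem theorem2: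
  fixes X K :: "complex set" and \<phi> :: "complex \<Rightarrow> complex" and M :: "nat \<Rightarrow> real"
  assumes "perfect X" and "compact X"
    and "\<phi> \<in> X \<rightarrow> X" and "extends_analytically X \<phi>"
    and "weight_sequence M" and "nonanalytic M"
    and "K = {z \<in> X. norm (deriv_in X \<phi> z) \<ge> 1}"
    and "\<phi> ` K \<subseteq> interior X"
  shows "induces_endomorphism X M \<phi>"
  unfolding induces_endomorphism_def
proof
  fix f assume f: "f \<in> D_alg X M"
  show "f \<circ> \<phi> \<in> D_alg X M"
  proof (cases "X = {}")
    case True
    \<comment> \<open>All functions have the same \<open>sup_norm\<close> over the empty set, whatever its value.\<close>
    then show ?thesis
      using f by (auto simp: D_alg_def D_infty_def sup_norm_def holomorphic_on_def split: if_splits)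
  next
    case False
    obtain U g where g: "open U" "X \<subseteq> U" "g holomorphic_on U" "\<And>z. z \<in> X \<Longrightarrow> g z = \<phi> z"
      using \<open>extends_analytically X \<phi>\<close> by (auto simp: extends_analytically_def)
    have "deriv_in X \<phi> z = deriv g z" if "z \<in> X" for z
    proof -
      have "deriv_in X \<phi> z = deriv_in X g z"
        using g that by (intro deriv_in_cong) auto
      also have "\<dots> = deriv g z"
        using g that \<open>perfect X\<close>
        by (intro deriv_in_eq has_field_derivative_at_within [OF holomorphic_derivI [of g U]])
           (auto simp: perfect_def)
      finally show ?thesis .
    qed
    then have "g z \<in> interior X" if "z \<in> X" "norm (deriv g z) \<ge> 1" for z
      using assms(7,8) g(4) that by auto
    then show ?thesis
      using comp_mem_D_alg [OF assms(1,2) False assms(3) g(3,1,2,4) assms(5,6) _ f] by blast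
  qed
qed

end
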